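(* Let $\mathbb F\in\{\mathbb R,\mathbb C\}$ and let $l,m,n$ be positive integers with $l< m\le n$. If $\mathcal P=\{P_j\}_{j=1}^n$ is a Grassmannian $(n,l)$-fusion frame for $\mathbb F^m$, then its spatial complement $\mathcal P^\perp:=\{I_m-P_j\}_{j=1}^n$ is a Grassmannian $(n,m-l)$-fusion frame for $\mathbb F^m$, and $$\mu_{n,m-l,\mathbb F^m}=m-2l+\mu_{n,l,\mathbb F^m}.$$
   Context: An $(n,l)$-packing for $\mathbb F^m$ is a finite sequence of $n$ $l$-dimensional subspaces of $\mathbb F^m$, identified with the sequence $\{P_j\}_{j=1}^n$ of orthogonal projections ($P_j=P_j^2=P_j^*$, $\operatorname{tr}(P_j)=l$) onto them. The coherence of a packing is $\mu(\mathcal P):=\max_{j\ne j'}\operatorname{tr}(P_jP_{j'})$, and the packing constant is $\mu_{n,l,\mathbb F^m}:=\inf\mu(\mathcal P)$, the infimum over all $(n,l)$-packings for $\mathbb F^m$. A packing is optimally spread if $\mu(\mathcal P)=\mu_{n,l,\mathbb F^m}$. An $(n,l)$-packing is an $(n,l)$-fusion frame for $\mathbb F^m$ if $\sum_{j=1}^nP_j$ is positive definite, and a fusion frame is Grassmannian if it is optimally spread. $I_m$ is the $m\times m$ identity matrix. *)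

theory Defs
  imports "HOL-Analysis.Analysis" "Jordan_Normal_Form.Conjugate"
begin

(* The definitions are polymorphic in the scalar type 'a, which is meant to be real or complex.
   conjugate is the identity on real and cnj on complex; the inner product of HOL-Analysis is
   x * y on real and Re (cnj x * y) on complex. *)

definition conj_transpose ::
    "'a::conjugate ^ 'm ^ 'm \<Rightarrow> 'a ^ 'm ^ 'm" where
  "conj_transpose A = (\<chi> i j. conjugate (A $ j $ i))"

definition orth_projection ::
    "'a::{conjugatable_field} ^ 'm ^ 'm \<Rightarrow> bool" where
  "orth_projection P \<longleftrightarrow> P ** P = P \<and> conj_transpose P = P"

(* For a self-adjoint A the scalar x* A x is real, and the inner product below, which is
   its real part, is equal to it. *)
definition positive_definite ::
    "'a::{conjugatable_field, real_inner} ^ 'm ^ 'm \<Rightarrow> bool" where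
  "positive_definite A \<longleftrightarrow>
     conj_transpose A = A \<and> (\<forall>x. x \<noteq> 0 \<longrightarrow> 0 < x \<bullet> (A *v x))"

(* A sequence of n matrices is a function on nat of which only the values at 1, ..., n matter. *)
definition packing ::
    "nat \<Rightarrow> nat \<Rightarrow> (nat \<Rightarrow> 'a::{conjugatable_field} ^ 'm ^ 'm) \<Rightarrow> bool" where
  "packing n l P \<longleftrightarrow> (\<forall>j\<in>{1..n}. orth_projection (P j) \<and> trace (P j) = of_nat l)"

(* The trace of a product of two self-adjoint matrices is real; z \<bullet> 1 is z for real z and
   Re z for complex z, so that the coherence is a real number for both kinds of scalars.
   Meaningful only for n >= 2 (Max of a nonempty set). *)
definition coherence ::
    "nat \<Rightarrow> (nat \<Rightarrow> 'a::{conjugatable_field, real_inner} ^ 'm ^ 'm) \<Rightarrow> real" where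
  "coherence n P =
     Max {trace (P j ** P j') \<bullet> 1 | j j'. j \<in> {1..n} \<and> j' \<in> {1..n} \<and> j \<noteq> j'}"

(* The first argument TYPE('a ^ 'm) only names the ambient space. *)
definition packing_constant ::
    "('a::{conjugatable_field, real_inner} ^ 'm) itself \<Rightarrow> nat \<Rightarrow> nat \<Rightarrow> real" where
  "packing_constant V n l = Inf {coherence n P | P :: nat \<Rightarrow> 'a ^ 'm ^ 'm. packing n l P}"

definition optimally_spread ::
    "nat \<Rightarrow> nat \<Rightarrow> (nat \<Rightarrow> 'a::{conjugatable_field, real_inner} ^ 'm ^ 'm) \<Rightarrow> bool" where
  "optimally_spread n l P \<longleftrightarrow>
     packing n l P \<and> coherence n P = packing_constant TYPE('a ^ 'm) n l"

definition fusion_frame ::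
    "nat \<Rightarrow> nat \<Rightarrow> (nat \<Rightarrow> 'a::{conjugatable_field, real_inner} ^ 'm ^ 'm) \<Rightarrow> bool" where
  "fusion_frame n l P \<longleftrightarrow> packing n l P \<and> positive_definite (\<Sum>j = 1..n. P j)"

definition grassmannian_fusion_frame ::
    "nat \<Rightarrow> nat \<Rightarrow> (nat \<Rightarrow> 'a::{conjugatable_field, real_inner} ^ 'm ^ 'm) \<Rightarrow> bool" where
  "grassmannian_fusion_frame n l P \<longleftrightarrow> fusion_frame n l P \<and> optimally_spread n l P"

definition spatial_complement ::
    "(nat \<Rightarrow> 'a::{conjugatable_field} ^ 'm ^ 'm) \<Rightarrow> nat \<Rightarrow> 'a ^ 'm ^ 'm" where
  "spatial_complement P = (\<lambda>j. mat 1 - P j)"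

end

(* Passing to complements shifts all inner products tr(P_j P_k), hence coherences and packing
   constants, by m - 2l; only positive definiteness of the sum of the N_j = I - P_j needs an
   argument. If it fails, some unit vector x is killed by all N_j. Turning a unit vector of the
   range of N_j towards x lowers tr(N_j N_k) for every k with N_k N_j nonzero. Doing this for
   j = 1, ..., n in turn, by smaller and smaller angles, yields a packing of smaller coherence,
   contradicting optimality. The coherence to start from is positive, since n >= m mutually
   orthogonal nonzero subspaces do not fit into the complement of x. *)

theory Submission
  imports Defs
begin

section \<open>Real and complex scalars under one class\<close>

text \<open>Collects what the argument needs from the scalars, so that it runs once for both fields.
  Here \<open>z \<bullet> 1\<close> plays the role of the real part of \<open>z\<close>.\<close>

class real_or_complex_field = conjugatable_field + real_normed_field + real_inner +
  assumes conjugate_scaleR_one: "conjugate (r *\<^sub>R 1) = r *\<^sub>R 1"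
    and inner_eq_conjugate_mult: "x \<bullet> y = (conjugate x * y) \<bullet> 1"
    and conjugate_mult_scaleR: "conjugate x * x = (norm x)\<^sup>2 *\<^sub>R 1"

instance real :: real_or_complex_field
  by intro_classes (auto simp: power2_eq_square)

instance complex :: real_or_complex_field
proof
  fix r :: real and x y :: complex
  show "conjugate (r *\<^sub>R 1) = r *\<^sub>R (1::complex)" by simp
  show "x \<bullet> y = (conjugate x * y) \<bullet> 1" by (simp add: inner_complex_def)
  have "conjugate x * x = x * cnj x" by (simp add: mult.commute)
  then show "conjugate x * x = (norm x)\<^sup>2 *\<^sub>R 1"
    by (simp only: complex_norm_square[symmetric] of_real_def[symmetric])
qed

lemma conjugate_of_real: "conjugate (of_real r) = (of_real r :: 'a::real_or_complex_field)"
  by (simp add: of_real_def conjugate_scaleR_one)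

lemma conjugate_mult_self:
  "conjugate x * x = of_real ((norm (x::'a::real_or_complex_field))\<^sup>2)"
  by (simp only: of_real_def conjugate_mult_scaleR)

lemma of_real_inner_one:
  "of_real r \<bullet> (1::'a::real_or_complex_field) = r"
  by (simp add: of_real_def norm_eq_1[symmetric])

lemma of_nat_inner_one:
  "of_nat k \<bullet> (1::'a::real_or_complex_field) = real k"
  using of_real_inner_one[of "real k"] by simp

lemma conjugate_one: "conjugate (1::'a::real_or_complex_field) = 1"
  using conjugate_of_real[of 1, where 'a='a] by simp

lemma conjugate_diff: "conjugate (x - y) = conjugate x - conjugate (y::'a::real_or_complex_field)"
  by (simp only: diff_conv_add_uminus conjugate_dist_add conjugate_neg)

section \<open>The Hermitian form and the Frobenius inner product\<close>

text \<open>The scalar-valued inner product, conjugate-linear in \<open>u\<close>. The vector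
  operation \<open>\<bullet>\<close> is only its real part, which over the complex numbers is too
  little to compute with rank-one matrices.\<close>

definition hermitian_form :: "'a::real_or_complex_field ^ 'm \<Rightarrow> 'a ^ 'm \<Rightarrow> 'a" where
  "hermitian_form u v = (\<Sum>i\<in>UNIV. conjugate (u $ i) * v $ i)"

lemma inner_eq_hermitian_form: "u \<bullet> v = hermitian_form u v \<bullet> 1"
  unfolding inner_vec_def hermitian_form_def inner_sum_left
  by (subst inner_eq_conjugate_mult) (rule refl)

lemma hermitian_form_self: "hermitian_form u u = of_real ((norm u)\<^sup>2)"
  unfolding hermitian_form_def conjugate_mult_self
  by (simp add: norm_vec_def L2_set_def sum_nonneg)

lemma hermitian_form_commute: "hermitian_form v u = conjugate (hermitian_form u v)"
  by (simp add: hermitian_form_def sum_conjugate conjugate_dist_mul mult.commute)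

lemma hermitian_form_add_right:
  "hermitian_form u (v + w) = hermitian_form u v + hermitian_form u w"
  by (simp add: hermitian_form_def sum.distrib algebra_simps)

lemma hermitian_form_scaleR_right:
  "hermitian_form u (r *\<^sub>R v) = r *\<^sub>R hermitian_form u v"
  by (simp add: hermitian_form_def scaleR_sum_right)

lemma hermitian_form_adjoint:
  "hermitian_form (A *v u) v = hermitian_form u (conj_transpose A *v v)"
  unfolding hermitian_form_def matrix_vector_mult_def conj_transpose_def
  by (simp add: sum_conjugate conjugate_dist_mul sum_distrib_left sum_distrib_right mult.assoc
      mult.left_commute) (rule sum.swap)

lemma inner_adjoint:
  fixes A :: "'a::real_or_complex_field ^ 'm ^ 'm"
  shows "(A *v u) \<bullet> v = u \<bullet> (conj_transpose A *v v)"
  by (simp add: inner_eq_hermitian_form hermitian_form_adjoint)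

lemma conj_transpose_mult:
  fixes A B :: "'a::real_or_complex_field ^ 'm ^ 'm"
  shows "conj_transpose (A ** B) = conj_transpose B ** conj_transpose A"
  by (simp add: conj_transpose_def matrix_matrix_mult_def vec_eq_iff sum_conjugate
      conjugate_dist_mul mult.commute)

lemma conj_transpose_add:
  fixes A B :: "'a::real_or_complex_field ^ 'm ^ 'm"
  shows "conj_transpose (A + B) = conj_transpose A + conj_transpose B"
  by (simp add: conj_transpose_def vec_eq_iff conjugate_dist_add)

lemma conj_transpose_diff:
  fixes A B :: "'a::real_or_complex_field ^ 'm ^ 'm"
  shows "conj_transpose (A - B) = conj_transpose A - conj_transpose B"
  by (simp add: conj_transpose_def vec_eq_iff conjugate_diff)

lemma conj_transpose_zero:
  "conj_transpose 0 = (0 :: 'a::real_or_complex_field ^ 'm ^ 'm)"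
  by (simp add: conj_transpose_def vec_eq_iff)

lemma conj_transpose_mat_one:
  "conj_transpose (mat 1) = (mat 1 :: 'a::real_or_complex_field ^ 'm ^ 'm)"
  by (simp add: conj_transpose_def mat_def vec_eq_iff conjugate_one)

section \<open>Matrix algebra and the trace form\<close>

lemma matrix_diff_distribs:
  fixes A B :: "'a::ring_1 ^ 'n ^ 'm" and C D :: "'a ^ 'k ^ 'n"
  shows "A ** (C - D) = A ** C - A ** D" and "(A - B) ** C = A ** C - B ** C"
  by (simp_all add: matrix_matrix_mult_def vec_eq_iff algebra_simps sum_subtractf)

lemma matrix_add_rdistrib:
  fixes A B :: "'a::ring_1 ^ 'n ^ 'm"
  shows "(A + B) ** C = A ** C + B ** C"
  by (simp add: matrix_matrix_mult_def vec_eq_iff algebra_simps sum.distrib)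

lemma matrix_vector_scaleR:
  fixes A :: "'a::real_algebra_1 ^ 'n ^ 'm"
  shows "A *v (r *\<^sub>R x) = r *\<^sub>R (A *v x)"
  by (simp add: matrix_vector_mult_def vec_eq_iff scaleR_sum_right)

lemma matrix_mult_zero:
  fixes A :: "'a::ring_1 ^ 'n ^ 'm"
  shows "A ** 0 = 0" and "0 ** A = 0"
  by (simp_all add: matrix_matrix_mult_def vec_eq_iff)

lemma matrix_mult_sum_left:
  fixes A :: "'b \<Rightarrow> 'a::ring_1 ^ 'n ^ 'm"
  shows "(\<Sum>i\<in>I. A i) ** B = (\<Sum>i\<in>I. A i ** B)"
  by (induction I rule: infinite_finite_induct)
    (simp_all add: matrix_mult_zero matrix_add_rdistrib)

lemma matrix_vector_mult_sum_left:
  fixes A :: "'b \<Rightarrow> 'a::ring_1 ^ 'n ^ 'm"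
  shows "(\<Sum>i\<in>I. A i) *v x = (\<Sum>i\<in>I. A i *v x)"
  by (induction I rule: infinite_finite_induct)
    (simp_all add: matrix_vector_mult_add_rdistrib)

text \<open>For self-adjoint \<open>A\<close> this identifies the entries of
  \<open>coherence\<close> with the Euclidean inner product of matrices, which is bilinear,
  symmetric and continuous.\<close>

lemma frobenius_inner:
  fixes A B :: "'a::real_or_complex_field ^ 'm ^ 'm"
  shows "A \<bullet> B = trace (conj_transpose A ** B) \<bullet> 1"
proof -
  have "A \<bullet> B = (\<Sum>i\<in>UNIV. \<Sum>j\<in>UNIV. (conjugate (A $ i $ j) * B $ i $ j) \<bullet> 1)"
    unfolding inner_vec_def by (subst inner_eq_conjugate_mult) (rule refl)
  also have "\<dots> = (\<Sum>j\<in>UNIV. \<Sum>i\<in>UNIV. (conjugate (A $ i $ j) * B $ i $ j) \<bullet> 1)"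
    by (rule sum.swap)
  also have "\<dots> = trace (conj_transpose A ** B) \<bullet> 1"
    by (simp add: trace_def conj_transpose_def matrix_matrix_mult_def inner_sum_left)
  finally show ?thesis .
qed

section \<open>Orthogonal projections\<close>

lemma orth_projectionD:
  assumes "orth_projection P"
  shows "P ** P = P" and "conj_transpose P = P"
  using assms by (simp_all add: orth_projection_def)

lemma orth_projection_complement:
  fixes P :: "'a::real_or_complex_field ^ 'm ^ 'm"
  assumes "orth_projection P"
  shows "orth_projection (mat 1 - P)"
  using assms
  by (simp add: orth_projection_def matrix_diff_distribs conj_transpose_diff
      conj_transpose_mat_one)

lemma orth_projection_inner:
  fixes P :: "'a::real_or_complex_field ^ 'm ^ 'm"
  assumes "orth_projection P"
  shows "x \<bullet> (P *v x) = (norm (P *v x))\<^sup>2"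
  by (metis assms inner_adjoint matrix_vector_mul_assoc orth_projectionD power2_norm_eq_inner)

text \<open>Cyclicity of the trace collapses the trace of \<open>Q ** P ** P ** Q\<close> to that of
  \<open>P ** Q\<close>. Hence the inner product is nonnegative and vanishes only if
  \<open>P ** Q = 0\<close>.\<close>

lemma inner_orth_projections:
  fixes P Q :: "'a::real_or_complex_field ^ 'm ^ 'm"
  assumes "orth_projection P" "orth_projection Q"
  shows "P \<bullet> Q = (norm (P ** Q))\<^sup>2"
proof -
  have "(norm (P ** Q))\<^sup>2 = trace (conj_transpose (P ** Q) ** (P ** Q)) \<bullet> 1"
    by (simp add: power2_norm_eq_inner frobenius_inner)
  also have "conj_transpose (P ** Q) ** (P ** Q) = Q ** (P ** P) ** Q"
    using assms by (simp only: conj_transpose_mult orth_projectionD(2) matrix_mul_assoc)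
  also have "trace \<dots> = trace (Q ** (Q ** P))"
    using assms by (simp only: orth_projectionD trace_mul_sym[of "Q ** P" Q])
  also have "\<dots> = trace (P ** Q)"
    using assms by (simp only: matrix_mul_assoc orth_projectionD trace_mul_sym[of Q P])
  finally show ?thesis
    using assms by (simp add: frobenius_inner orth_projectionD)
qed

lemma orth_projection_sum:
  fixes P :: "'b \<Rightarrow> 'a::real_or_complex_field ^ 'm ^ 'm"
  assumes "finite I" and "\<And>i. i \<in> I \<Longrightarrow> orth_projection (P i)"
    and "\<And>i j. i \<in> I \<Longrightarrow> j \<in> I \<Longrightarrow> i \<noteq> j \<Longrightarrow> P i ** P j = 0"
  shows "orth_projection (\<Sum>i\<in>I. P i)"
  using assms
proof (induction I rule: finite_induct)
  case empty
  show ?case by (simp add: orth_projection_def conj_transpose_zero matrix_mult_zero)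
next
  case (insert i I)
  let ?S = "\<Sum>i\<in>I. P i"
  have S: "orth_projection ?S" and i: "orth_projection (P i)"
    using insert by auto
  have "?S ** P i = (\<Sum>j\<in>I. 0)"
    unfolding matrix_mult_sum_left by (rule sum.cong) (use insert in auto)
  then have Si: "?S ** P i = 0" by simp
  \<comment> \<open>Taking adjoints reverses the product, so the other cross term vanishes
    too.\<close>
  then have "conj_transpose (?S ** P i) = 0" by (simp add: conj_transpose_zero)
  then have iS: "P i ** ?S = 0"
    using S i by (simp add: conj_transpose_mult orth_projectionD)
  show ?case
    using S i Si iS insert
    by (simp add: orth_projection_def conj_transpose_add matrix_add_ldistrib matrix_add_rdistrib)
qed

lemma trace_sum:
  fixes A :: "'b \<Rightarrow> 'a::real_or_complex_field ^ 'm ^ 'm"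
  shows "trace (\<Sum>i\<in>I. A i) = (\<Sum>i\<in>I. trace (A i))"
  by (induction I rule: infinite_finite_induct) (simp_all add: trace_add trace_0[unfolded mat_0])

section \<open>Rank-one matrices and exchanging a line in the range of a projection\<close>

definition rank_one :: "'a::real_or_complex_field ^ 'm \<Rightarrow> 'a ^ 'm \<Rightarrow> 'a ^ 'm ^ 'm" where
  "rank_one u v = (\<chi> i j. u $ i * conjugate (v $ j))"

lemma conj_transpose_rank_one: "conj_transpose (rank_one u v) = rank_one v u"
  by (simp add: conj_transpose_def rank_one_def vec_eq_iff conjugate_dist_mul mult.commute)

lemma mult_rank_one: "A ** rank_one u v = rank_one (A *v u) v"
  by (simp add: matrix_matrix_mult_def matrix_vector_mult_def rank_one_def vec_eq_iff
      sum_distrib_right mult.assoc)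

lemma rank_one_mult:
  fixes A :: "'a::real_or_complex_field ^ 'm ^ 'm"
  shows "rank_one u v ** A = rank_one u (conj_transpose A *v v)"
  by (simp add: matrix_matrix_mult_def matrix_vector_mult_def rank_one_def vec_eq_iff
      conj_transpose_def sum_conjugate conjugate_dist_mul sum_distrib_left mult_ac)

text \<open>The form is taken to be real so that the result is a real multiple of \<open>u\<close>;
  the values that occur later are 1 and \<open>cos t\<close>.\<close>

lemma rank_one_mult_vec:
  assumes "hermitian_form v w = of_real r"
  shows "rank_one u v *v w = r *\<^sub>R u"
proof -
  have "(rank_one u v *v w) $ i = u $ i * hermitian_form v w" for i
    by (simp add: matrix_vector_mult_def rank_one_def hermitian_form_def sum_distrib_left mult.assoc)
  moreover have "(r *\<^sub>R u) $ i = u $ i * of_real r" for i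
    by (simp add: scaleR_conv_of_real[of r "u $ i"])
  ultimately show ?thesis
    using assms by (simp add: vec_eq_iff)
qed

lemma trace_rank_one: "trace (rank_one u v) = hermitian_form v u"
  by (simp add: trace_def rank_one_def hermitian_form_def mult.commute)

lemma rank_one_zero: "rank_one 0 v = 0" "rank_one u 0 = 0"
  by (simp_all add: rank_one_def vec_eq_iff)

lemma rank_one_inner:
  fixes A :: "'a::real_or_complex_field ^ 'm ^ 'm"
  assumes "conj_transpose A = A"
  shows "rank_one u u \<bullet> A = u \<bullet> (A *v u)"
proof -
  have "rank_one u u \<bullet> A = trace (A ** rank_one u u) \<bullet> 1"
    by (simp add: frobenius_inner conj_transpose_rank_one trace_mul_sym[of A])
  then show ?thesis
    by (simp add: mult_rank_one trace_rank_one inner_eq_hermitian_form)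
qed

lemma orth_projection_rank_one:
  assumes "norm u = 1"
  shows "orth_projection (rank_one u u)"
  using assms
  by (simp add: orth_projection_def conj_transpose_rank_one mult_rank_one
      rank_one_mult_vec[where r = 1] hermitian_form_self)

text \<open>Since \<open>P\<close> fixes \<open>z\<close>, both products of \<open>P\<close> with
  \<open>rank_one z z\<close> equal \<open>rank_one z z\<close>: the line of \<open>z\<close> is
  split off from the range.\<close>

lemma orth_projection_minus_rank_one:
  assumes P: "orth_projection P" and z: "P *v z = z" "norm z = 1"
  shows "orth_projection (P - rank_one z z)"
  using P z orth_projectionD[OF P] orth_projectionD[OF orth_projection_rank_one[OF z(2)]]
  by (simp add: orth_projection_def matrix_diff_distribs conj_transpose_diff mult_rank_one
      rank_one_mult matrix_vector_mult_diff_rdistrib rank_one_zero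
      rank_one_mult_vec[where r = 1] hermitian_form_self)

text \<open>Since \<open>P\<close> kills \<open>z\<close>, both cross products vanish: the line of
  \<open>z\<close> is adjoined to the range.\<close>

lemma orth_projection_plus_rank_one:
  assumes P: "orth_projection P" and z: "P *v z = 0" "norm z = 1"
  shows "orth_projection (P + rank_one z z)"
  using P z orth_projectionD[OF P] orth_projectionD[OF orth_projection_rank_one[OF z(2)]]
  by (simp add: orth_projection_def matrix_add_ldistrib matrix_add_rdistrib conj_transpose_add
      mult_rank_one rank_one_mult rank_one_zero matrix_vector_mult_add_rdistrib
      rank_one_mult_vec[where r = 1] hermitian_form_self)

section \<open>Lowering the coherence of a packing with a common kernel vector\<close>

text \<open>Finitely many proper subspaces do not cover the space. In the induction step,
  \<open>w\<close> lies outside the new kernel, and all but finitely many points of the real line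
  \<open>v + r *\<^sub>R w\<close> avoid every kernel.\<close>

lemma exists_vector_avoiding_kernels:
  fixes \<A> :: "('a::real_or_complex_field ^ 'm ^ 'm) set"
  assumes "finite \<A>" and "0 \<notin> \<A>"
  shows "\<exists>v. \<forall>A\<in>\<A>. A *v v \<noteq> 0"
  using assms
proof (induction \<A> rule: finite_induct)
  case empty
  then show ?case by simp
next
  case (insert B \<A>)
  then obtain v where v: "\<forall>A\<in>\<A>. A *v v \<noteq> 0" by auto
  obtain w where w: "B *v w \<noteq> 0"
    using insert.prems by (metis insertI1 matrix_eq matrix_vector_mult_0)
  define bad where "bad A = {r::real. A *v (v + r *\<^sub>R w) = 0}" for A :: "'a ^ 'm ^ 'm"
  \<comment> \<open>Two different bad parameters would force \<open>A\<close> to kill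
    \<open>w\<close> and then \<open>v\<close>, so there is at most one.\<close>
  have "finite (bad A)" if A: "A *v v \<noteq> 0 \<or> A *v w \<noteq> 0" for A :: "'a ^ 'm ^ 'm"
  proof -
    have "r = s" if "r \<in> bad A" "s \<in> bad A" for r s
    proof (rule ccontr)
      assume "r \<noteq> s"
      have r: "A *v v + r *\<^sub>R (A *v w) = 0" and s: "A *v v + s *\<^sub>R (A *v w) = 0"
        using that by (simp_all add: bad_def matrix_vector_right_distrib matrix_vector_scaleR)
      then have "(r - s) *\<^sub>R (A *v w) = 0"
        by (metis add_left_cancel eq_iff_diff_eq_0 scaleR_left_diff_distrib)
      then have "A *v w = 0" using \<open>r \<noteq> s\<close> by simp
      with r A show False by simp
    qed
    then show ?thesis
      by (metis (no_types, lifting) finite.simps finite_subset insertCI subsetI)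
  qed
  then have "finite (\<Union>A\<in>insert B \<A>. bad A)"
    using insert.hyps v w by auto
  then obtain r where "r \<notin> (\<Union>A\<in>insert B \<A>. bad A)"
    using infinite_UNIV_char_0 ex_new_if_finite by blast
  then show ?case by (auto simp: bad_def)
qed

text \<open>
  A unit vector \<open>z\<close> in the range of \<open>P\<close> is turned by a small angle towards \<open>x\<close>. Against a
  projection \<open>K\<close> that kills \<open>x\<close>, this multiplies the contribution of \<open>z\<close> by the square of the
  cosine, a strict decrease when \<open>K z \<noteq> 0\<close>.
\<close>
lemma perturb_orth_projection:
  fixes P :: "'a::real_or_complex_field ^ 'm ^ 'm"
  assumes P: "orth_projection P" and x: "norm x = 1" "P *v x = 0" and "0 < \<mu>"
    and \<A>: "finite \<A>" "\<And>K. K \<in> \<A> \<Longrightarrow> orth_projection K \<and> K *v x = 0 \<and> P \<bullet> K \<le> \<mu>"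
    and \<B>: "finite \<B>" "\<And>K. K \<in> \<B> \<Longrightarrow> orth_projection K \<and> P \<bullet> K < \<mu>"
  obtains Q where "orth_projection Q" "trace Q = trace P" "\<And>K. K \<in> \<A> \<union> \<B> \<Longrightarrow> Q \<bullet> K < \<mu>"
proof -
  have orth: "P \<bullet> K = 0" if "K \<in> \<A>" "K ** P = 0" for K
    using inner_orth_projections[of K P] \<A>(2)[OF that(1)] P that(2) by (simp add: inner_commute)
  \<comment> \<open>A single \<open>v\<close> serves all \<open>K\<close> in \<A> that are not
    orthogonal to \<open>P\<close>, so one rotation lowers all their inner products at once.\<close>
  obtain v where v: "\<And>K. K \<in> \<A> \<Longrightarrow> K ** P \<noteq> 0 \<Longrightarrow> (K ** P) *v v \<noteq> 0"
    using exists_vector_avoiding_kernels[of "(\<lambda>K. K ** P) ` \<A> - {0}"] \<A>(1) by fastforce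
  show ?thesis
  proof (cases "P *v v = 0")
    \<comment> \<open>In this degenerate case every \<open>K\<close> in \<A> is orthogonal to
      \<open>P\<close>, and \<open>P\<close> itself is the required \<open>Q\<close> because \<mu>
      is positive.\<close>
    case True
    then have "K ** P = 0" if "K \<in> \<A>" for K
      using v[OF that] by (metis matrix_vector_mul_assoc matrix_vector_mult_0_right)
    then have "P \<bullet> K < \<mu>" if "K \<in> \<A> \<union> \<B>" for K
      using orth \<B>(2) \<open>0 < \<mu>\<close> that by fastforce
    then show ?thesis using P that by blast
  next
    case False
    define z where "z = (1 / norm (P *v v)) *\<^sub>R (P *v v)"
    have nz: "norm z = 1" using False by (simp add: z_def)
    have Pz: "P *v z = z"
      using P by (simp add: z_def matrix_vector_scaleR matrix_vector_mul_assoc orth_projectionD)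
    have Kz: "K *v z \<noteq> 0" if "K \<in> \<A>" "K ** P \<noteq> 0" for K
      using v[OF that] False by (simp add: z_def matrix_vector_scaleR matrix_vector_mul_assoc)
    have zx: "hermitian_form z x = 0"
      using hermitian_form_adjoint[of P z x] P x(2)
      by (simp add: Pz orth_projectionD hermitian_form_def)
    have xz: "hermitian_form x z = 0"
      using hermitian_form_commute[of x z] zx by simp
    \<comment> \<open>\<open>y t\<close> is \<open>z\<close> turned by the angle \<open>t\<close>
      towards \<open>x\<close>, and \<open>Q t\<close> replaces the line of \<open>z\<close> in the
      range of \<open>P\<close> by that of \<open>y t\<close>.\<close>
    define y where "y t = cos t *\<^sub>R z + sin t *\<^sub>R x" for t
    define Q where "Q t = P - rank_one z z + rank_one (y t) (y t)" for t
    have "z \<bullet> z = 1" "x \<bullet> x = 1" "z \<bullet> x = 0" "x \<bullet> z = 0"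
      using nz x(1) zx xz by (simp_all add: norm_eq_1 inner_eq_hermitian_form[of z x]
          inner_eq_hermitian_form[of x z])
    then have "y t \<bullet> y t = 1" for t
      by (simp add: y_def inner_add_left inner_add_right flip: power2_eq_square)
    then have ny: "norm (y t) = 1" for t
      by (simp add: norm_eq_1)
    have "hermitian_form z (y t) = of_real (cos t)" for t
      by (simp add: y_def hermitian_form_add_right hermitian_form_scaleR_right zx
          hermitian_form_self nz of_real_def)
    \<comment> \<open>\<open>P\<close> kills the \<open>x\<close> part of \<open>y t\<close>, and on
      the \<open>z\<close> part \<open>P\<close> and \<open>rank_one z z\<close> agree. So
      \<open>y t\<close> may be adjoined after removing \<open>z\<close>.\<close>
    then have "(P - rank_one z z) *v y t = 0" for t
      using Pz x(2)
      by (simp add: matrix_vector_mult_diff_rdistrib rank_one_mult_vec)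
        (simp add: y_def matrix_vector_right_distrib matrix_vector_scaleR)
    then have Q: "orth_projection (Q t)" for t
      unfolding Q_def
      using orth_projection_plus_rank_one orth_projection_minus_rank_one[OF P Pz nz] ny by blast
    have tr: "trace (Q t) = trace P" for t
      by (simp add: Q_def trace_add trace_sub trace_rank_one hermitian_form_self ny nz)
    have QK: "Q t \<bullet> K = P \<bullet> K - z \<bullet> (K *v z) + y t \<bullet> (K *v y t)" if "orth_projection K" for t K
      using orth_projectionD[OF that]
      by (simp add: Q_def inner_add_left inner_diff_left rank_one_inner)
    \<comment> \<open>Any angle strictly between 0 and a right angle works. If
      \<open>K ** P \<noteq> 0\<close> the decrease is strict; otherwise
      \<open>P \<bullet> K = 0\<close> is already below \<mu>.\<close>
    have less_A: "Q t \<bullet> K < \<mu>" if K: "K \<in> \<A>" and t: "0 < t" "t < pi / 2" for t K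
    proof -
      have K': "orth_projection K" "K *v x = 0" "P \<bullet> K \<le> \<mu>" using \<A>(2)[OF K] by auto
      have "K *v y t = cos t *\<^sub>R (K *v z)"
        using K' by (simp add: y_def matrix_vector_right_distrib matrix_vector_scaleR)
      then have "y t \<bullet> (K *v y t) = (cos t)\<^sup>2 * (norm (K *v z))\<^sup>2"
        unfolding orth_projection_inner[OF K'(1)] by (simp add: power_mult_distrib)
      then have eq: "Q t \<bullet> K = P \<bullet> K - (1 - (cos t)\<^sup>2) * (norm (K *v z))\<^sup>2"
        using K' by (simp add: QK orth_projection_inner algebra_simps)
      have "0 < 1 - (cos t)\<^sup>2"
        using t sin_gt_zero[of t] pi_gt_zero by (simp add: sin_squared_eq[symmetric])
      then have "K ** P \<noteq> 0 \<Longrightarrow> 0 < (1 - (cos t)\<^sup>2) * (norm (K *v z))\<^sup>2"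
        using Kz[OF K] by simp
      moreover have "0 \<le> (1 - (cos t)\<^sup>2) * (norm (K *v z))\<^sup>2"
        using \<open>0 < 1 - (cos t)\<^sup>2\<close> by simp
      ultimately show ?thesis
        using eq K' orth[OF K] \<open>0 < \<mu>\<close> by (cases "K ** P = 0") auto
    qed
    \<comment> \<open>Members of \<B> need not kill \<open>x\<close>, so only continuity is
      available: \<open>Q t \<bullet> K\<close> tends to \<open>P \<bullet> K\<close>, which is
      strictly below \<mu>.\<close>
    have less_B: "\<forall>\<^sub>F t in at_right 0. Q t \<bullet> K < \<mu>" if K: "K \<in> \<B>" for K
    proof -
      have K': "orth_projection K" "P \<bullet> K < \<mu>" using \<B>(2)[OF K] by auto
      have "((\<lambda>t. P \<bullet> K - z \<bullet> (K *v z) + (cos t *\<^sub>R z + sin t *\<^sub>R x) \<bullet>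
          (cos t *\<^sub>R (K *v z) + sin t *\<^sub>R (K *v x))) \<longlongrightarrow>
          P \<bullet> K - z \<bullet> (K *v z) + (cos 0 *\<^sub>R z + sin 0 *\<^sub>R x) \<bullet>
          (cos 0 *\<^sub>R (K *v z) + sin 0 *\<^sub>R (K *v x))) (at_right 0)"
        by (intro tendsto_intros)
      then have "((\<lambda>t. Q t \<bullet> K) \<longlongrightarrow> P \<bullet> K) (at_right 0)"
        using K' by (simp add: QK y_def matrix_vector_right_distrib matrix_vector_scaleR)
      then show ?thesis using K'(2) by (rule order_tendstoD(2))
    qed
    have "\<forall>\<^sub>F t in at_right (0::real). 0 < t \<and> t < pi / 2"
      unfolding eventually_at_right_field using pi_half_gt_zero by blast
    moreover have "\<forall>\<^sub>F t in at_right 0. \<forall>K\<in>\<B>. Q t \<bullet> K < \<mu>"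
      using \<B>(1) less_B by (simp add: eventually_ball_finite)
    ultimately have "\<forall>\<^sub>F t in at_right 0. \<forall>K\<in>\<A> \<union> \<B>. Q t \<bullet> K < \<mu>"
      by eventually_elim (use less_A in blast)
    then obtain t where "\<forall>K\<in>\<A> \<union> \<B>. Q t \<bullet> K < \<mu>"
      using eventually_happens' trivial_limit_at_right_real by blast
    then show ?thesis using that Q tr by blast
  qed
qed

text \<open>
  The members are perturbed one after the other; those already moved need not kill \<open>x\<close> any more,
  but their inner products with all others are strictly below the bound, hence stay so.
\<close>
lemma exists_packing_below:
  fixes N :: "nat \<Rightarrow> 'a::real_or_complex_field ^ 'm ^ 'm"
  assumes N: "packing n r N" and x: "norm x = 1" "\<And>j. j \<in> {1..n} \<Longrightarrow> N j *v x = 0" and "0 < \<mu>"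
    and le: "\<And>j k. j \<in> {1..n} \<Longrightarrow> k \<in> {1..n} \<Longrightarrow> j \<noteq> k \<Longrightarrow> N j \<bullet> N k \<le> \<mu>"
  shows "\<exists>M :: nat \<Rightarrow> 'a ^ 'm ^ 'm. packing n r M \<and>
    (\<forall>j\<in>{1..n}. \<forall>k\<in>{1..n}. j \<noteq> k \<longrightarrow> M j \<bullet> M k < \<mu>)"
proof -
  \<comment> \<open>Invariant after \<open>i\<close> moves: later members are untouched, and every
    pair containing a moved member is strictly below \<mu>.\<close>
  have "\<exists>M. packing n r M \<and> (\<forall>j\<in>{i<..n}. M j = N j) \<and>
      (\<forall>j\<in>{1..i}. \<forall>k\<in>{1..n}. j \<noteq> k \<longrightarrow> M j \<bullet> M k < \<mu>)" if "i \<le> n" for i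
    using that
  proof (induction i)
    case 0
    show ?case using N by (intro exI[of _ N]) auto
  next
    case (Suc i)
    then obtain M where M: "packing n r M" "\<forall>j\<in>{i<..n}. M j = N j"
      "\<forall>j\<in>{1..i}. \<forall>k\<in>{1..n}. j \<noteq> k \<longrightarrow> M j \<bullet> M k < \<mu>" by auto
    have proj: "orth_projection (M j)" if "j \<in> {1..n}" for j
      using M(1) that by (simp add: packing_def)
    obtain Q where Q: "orth_projection Q" "trace Q = trace (M (Suc i))"
      "\<And>K. K \<in> M ` {Suc i<..n} \<union> M ` {1..i} \<Longrightarrow> Q \<bullet> K < \<mu>"
    \<comment> \<open>The unmoved members, which still kill \<open>x\<close>, play the role of \<A>;
      the moved ones play that of \<B>.\<close>
    proof (rule perturb_orth_projection[of "M (Suc i)" x \<mu> "M ` {Suc i<..n}" "M ` {1..i}"])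
      show "orth_projection K \<and> K *v x = 0 \<and> M (Suc i) \<bullet> K \<le> \<mu>" if K: "K \<in> M ` {Suc i<..n}" for K
      proof -
        obtain k where "k \<in> {Suc i<..n}" "K = M k"
          using K by blast
        then have k: "k \<in> {1..n}" "k \<in> {i<..n}" "k \<noteq> Suc i" "K = M k"
          by auto
        moreover have "M (Suc i) = N (Suc i)" "M k = N k"
          using M(2) k(2) Suc.prems by auto
        ultimately show ?thesis
          using proj[of k] x(2)[of k] le[of "Suc i" k] Suc.prems by simp
      qed
      show "orth_projection K \<and> M (Suc i) \<bullet> K < \<mu>" if "K \<in> M ` {1..i}" for K
        using that proj M(3) Suc.prems by (auto simp: inner_commute)
      show "orth_projection (M (Suc i))" using proj Suc.prems by simp
    qed (use M(2) x Suc.prems \<open>0 < \<mu>\<close> in auto)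
    have Qj: "Q \<bullet> M j < \<mu>" if "j \<in> {1..n}" "j \<noteq> Suc i" for j
    proof -
      have "j \<in> {Suc i<..n} \<union> {1..i}" using that by auto
      then show ?thesis using Q(3) by blast
    qed
    define M' where "M' = M(Suc i := Q)"
    have "packing n r M'"
      using M(1) Q Suc.prems by (auto simp: packing_def M'_def)
    moreover have "M' j \<bullet> M' k < \<mu>" if "j \<in> {1..Suc i}" "k \<in> {1..n}" "j \<noteq> k" for j k
      using that M(3) Qj[of j] Qj[of k] Suc.prems by (auto simp: M'_def inner_commute le_Suc_eq)
    moreover have "\<forall>j\<in>{Suc i<..n}. M' j = N j"
      using M(2) by (simp add: M'_def)
    ultimately show ?case by blast
  qed
  from this[of n] show ?thesis by auto
qed

text \<open>The sum of the \<open>N j\<close> is a projection of trace \<open>n * r\<close>. Its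
  complement fixes \<open>x\<close>, hence is a nonzero projection, and its trace is its squared
  norm and so positive.\<close>

lemma orthogonal_packing_bound:
  fixes N :: "nat \<Rightarrow> 'a::real_or_complex_field ^ 'm ^ 'm"
  assumes N: "packing n r N" and x: "x \<noteq> 0" "\<And>j. j \<in> {1..n} \<Longrightarrow> N j *v x = 0"
    and orth: "\<And>j k. j \<in> {1..n} \<Longrightarrow> k \<in> {1..n} \<Longrightarrow> j \<noteq> k \<Longrightarrow> N j ** N k = 0"
  shows "n * r < CARD('m)"
proof -
  let ?S = "\<Sum>j = 1..n. N j"
  have "orth_projection ?S"
    using N orth by (intro orth_projection_sum) (auto simp: packing_def)
  then have T: "orth_projection (mat 1 - ?S)" by (rule orth_projection_complement)
  have "(mat 1 - ?S) *v x = x"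
    using x(2) by (simp add: matrix_vector_mult_diff_rdistrib matrix_vector_mult_sum_left)
  then have "mat 1 - ?S \<noteq> 0" using x(1) by auto
  then have "0 < (mat 1 - ?S) \<bullet> (mat 1 - ?S)" by simp
  also have "\<dots> = trace (mat 1 - ?S) \<bullet> 1"
    using T by (simp only: frobenius_inner orth_projectionD)
  also have "trace (mat 1 - ?S) = of_nat CARD('m) - of_nat (n * r)"
    using N by (simp add: trace_sub trace_sum trace_I packing_def)
  also have "\<dots> \<bullet> 1 = real CARD('m) - real (n * r)"
    by (simp only: inner_diff_left of_nat_inner_one)
  finally have "real (n * r) < real CARD('m)" by simp
  then show ?thesis by (simp only: of_nat_less_iff)
qed

section \<open>Coherence and spatial complements\<close>

lemma coherence_pairs:
  defines "C P n \<equiv> {trace (P j ** P j') \<bullet> 1 | j j'. j \<in> {1..n} \<and> j' \<in> {1..n} \<and> j \<noteq> j'}"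
  fixes P :: "nat \<Rightarrow> 'a::real_or_complex_field ^ 'm ^ 'm"
  shows "finite (C P n)" and "2 \<le> n \<Longrightarrow> C P n \<noteq> {}"
proof -
  have "C P n \<subseteq> (\<lambda>(j, j'). trace (P j ** P j') \<bullet> 1) ` ({1..n} \<times> {1..n})"
    by (auto simp: C_def)
  then show "finite (C P n)" by (rule finite_subset) simp
  show "C P n \<noteq> {}" if "2 \<le> n"
  proof -
    have "trace (P 1 ** P 2) \<bullet> 1 \<in> C P n"
      unfolding C_def using that by fastforce
    then show ?thesis by blast
  qed
qed

lemma packing_inner:
  fixes P :: "nat \<Rightarrow> 'a::real_or_complex_field ^ 'm ^ 'm"
  assumes "packing n l P" "j \<in> {1..n}"
  shows "trace (P j ** P k) \<bullet> 1 = P j \<bullet> P k"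
  using assms by (simp add: packing_def frobenius_inner orth_projectionD)

lemma coherence_upper:
  fixes P :: "nat \<Rightarrow> 'a::real_or_complex_field ^ 'm ^ 'm"
  assumes "packing n l P" "j \<in> {1..n}" "k \<in> {1..n}" "j \<noteq> k"
  shows "P j \<bullet> P k \<le> coherence n P"
  unfolding coherence_def packing_inner[OF assms(1,2), symmetric]
  by (rule Max_ge[OF coherence_pairs(1)]) (use assms in auto)

lemma coherence_attained:
  fixes P :: "nat \<Rightarrow> 'a::real_or_complex_field ^ 'm ^ 'm"
  assumes "packing n l P" "2 \<le> n"
  obtains j k where "j \<in> {1..n}" "k \<in> {1..n}" "j \<noteq> k" "coherence n P = P j \<bullet> P k"
proof -
  have "coherence n P \<in> {trace (P j ** P j') \<bullet> 1 | j j'. j \<in> {1..n} \<and> j' \<in> {1..n} \<and> j \<noteq> j'}"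
    unfolding coherence_def by (intro Max_in coherence_pairs \<open>2 \<le> n\<close>)
  then show ?thesis
    using packing_inner[OF assms(1)] that by auto
qed

lemma coherence_nonneg:
  fixes P :: "nat \<Rightarrow> 'a::real_or_complex_field ^ 'm ^ 'm"
  assumes "packing n l P" "2 \<le> n"
  shows "0 \<le> coherence n P"
  using coherence_attained[OF assms] assms(1)
  by (metis inner_orth_projections packing_def zero_le_power2)

lemma packing_spatial_complement:
  fixes P :: "nat \<Rightarrow> 'a::real_or_complex_field ^ 'm ^ 'm"
  assumes "packing n l P" "l \<le> CARD('m)"
  shows "packing n (CARD('m) - l) (spatial_complement P)"
  using assms
  by (simp add: packing_def spatial_complement_def orth_projection_complement trace_sub trace_I
      of_nat_diff)

text \<open>Expand bilinearly: the identity has squared norm \<open>CARD('m)\<close>, and its inner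
  product with each \<open>P i\<close> is \<open>l\<close>. The shift is thus the same for all
  pairs.\<close>

lemma spatial_complement_inner:
  fixes P :: "nat \<Rightarrow> 'a::real_or_complex_field ^ 'm ^ 'm"
  assumes "packing n l P" "j \<in> {1..n}" "k \<in> {1..n}"
  shows "spatial_complement P j \<bullet> spatial_complement P k
    = real CARD('m) - 2 * real l + P j \<bullet> P k"
proof -
  have "mat 1 \<bullet> P i = real l" if "i \<in> {1..n}" for i
    using assms(1) that
    by (simp add: frobenius_inner conj_transpose_mat_one packing_def of_nat_inner_one)
  moreover have "mat 1 \<bullet> (mat 1 :: 'a ^ 'm ^ 'm) = real CARD('m)"
    by (simp add: frobenius_inner conj_transpose_mat_one trace_I of_nat_inner_one)
  ultimately show ?thesis
    using assms(2,3)
    by (simp add: spatial_complement_def inner_diff_left inner_diff_right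
        inner_commute[of "P j" "mat 1"])
qed

text \<open>The common shift preserves the order of the pairs, so a pair attaining either maximum
  bounds the other one.\<close>

lemma coherence_spatial_complement:
  fixes P :: "nat \<Rightarrow> 'a::real_or_complex_field ^ 'm ^ 'm"
  assumes P: "packing n l P" and "l \<le> CARD('m)" "2 \<le> n"
  shows "coherence n (spatial_complement P) = real CARD('m) - 2 * real l + coherence n P"
proof (rule antisym)
  note N = packing_spatial_complement[OF assms(1,2)]
  show "coherence n (spatial_complement P) \<le> real CARD('m) - 2 * real l + coherence n P"
    using coherence_attained[OF N \<open>2 \<le> n\<close>]
    by (metis add_le_cancel_left coherence_upper[OF P] spatial_complement_inner[OF P])
  show "real CARD('m) - 2 * real l + coherence n P \<le> coherence n (spatial_complement P)"
    using coherence_attained[OF P \<open>2 \<le> n\<close>]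
    by (metis coherence_upper[OF N] spatial_complement_inner[OF P])
qed

section \<open>The packing constant as an infimum\<close>

lemma packing_constant_le:
  fixes P :: "nat \<Rightarrow> 'a::real_or_complex_field ^ 'm ^ 'm"
  assumes "packing n l P" "2 \<le> n"
  shows "packing_constant TYPE('a ^ 'm) n l \<le> coherence n P"
  unfolding packing_constant_def
  \<comment> \<open>Nonnegativity of coherence supplies the lower bound required of the set.\<close>
  by (rule cInf_lower) (use assms coherence_nonneg in \<open>auto intro!: bdd_belowI[of _ 0]\<close>)

text \<open>A packing contributes its own coherence to the set, so equality with the infimum means
  being a minimiser. Optimality can then be tested against one competitor at a time.\<close>

lemma optimally_spread_iff:
  fixes P :: "nat \<Rightarrow> 'a::real_or_complex_field ^ 'm ^ 'm"
  assumes "2 \<le> n"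
  shows "optimally_spread n l P \<longleftrightarrow>
    packing n l P \<and> (\<forall>Q :: nat \<Rightarrow> 'a ^ 'm ^ 'm. packing n l Q \<longrightarrow> coherence n P \<le> coherence n Q)"
proof
  assume "optimally_spread n l P"
  then show "packing n l P \<and> (\<forall>Q :: nat \<Rightarrow> 'a ^ 'm ^ 'm.
      packing n l Q \<longrightarrow> coherence n P \<le> coherence n Q)"
    using packing_constant_le[OF _ assms] by (auto simp: optimally_spread_def)
next
  assume *: "packing n l P \<and> (\<forall>Q :: nat \<Rightarrow> 'a ^ 'm ^ 'm.
      packing n l Q \<longrightarrow> coherence n P \<le> coherence n Q)"
  then have "Inf {coherence n P | P :: nat \<Rightarrow> 'a ^ 'm ^ 'm. packing n l P} = coherence n P"
    by (intro cInf_eq_minimum) auto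
  with * show "optimally_spread n l P"
    by (simp add: optimally_spread_def packing_constant_def)
qed

text \<open>Complementing a competitor \<open>Q\<close> yields a competitor of \<open>P\<close>. The
  two shifts, for dimensions \<open>l\<close> and \<open>CARD('m) - l\<close>, are opposite and
  cancel.\<close>

lemma optimally_spread_spatial_complement:
  fixes P :: "nat \<Rightarrow> 'a::real_or_complex_field ^ 'm ^ 'm"
  assumes P: "optimally_spread n l P" and "l \<le> CARD('m)" "2 \<le> n"
  shows "optimally_spread n (CARD('m) - l) (spatial_complement P)"
  unfolding optimally_spread_iff[OF \<open>2 \<le> n\<close>]
proof (intro conjI allI impI)
  have P': "packing n l P" using P by (simp add: optimally_spread_def)
  show "packing n (CARD('m) - l) (spatial_complement P)"
    using packing_spatial_complement[OF P'] assms by simp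
  fix Q :: "nat \<Rightarrow> 'a ^ 'm ^ 'm"
  assume Q: "packing n (CARD('m) - l) Q"
  then have "packing n l (spatial_complement Q)"
    using packing_spatial_complement[OF Q] assms by simp
  then have "coherence n P \<le> coherence n (spatial_complement Q)"
    using P optimally_spread_iff[OF \<open>2 \<le> n\<close>] by blast
  then show "coherence n (spatial_complement P) \<le> coherence n Q"
    using coherence_spatial_complement[OF P'] coherence_spatial_complement[OF Q] assms
    by (simp add: of_nat_diff)
qed

section \<open>Positive definiteness from optimality\<close>

lemma optimally_spread_no_common_kernel:
  fixes N :: "nat \<Rightarrow> 'a::real_or_complex_field ^ 'm ^ 'm"
  assumes N: "optimally_spread n r N" and "0 < r" "CARD('m) \<le> n" "2 \<le> n"
    and x: "x \<noteq> 0" "\<And>j. j \<in> {1..n} \<Longrightarrow> N j *v x = 0"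
  shows False
proof -
  let ?\<mu> = "coherence n N"
  have pack: "packing n r N" using N by (simp add: optimally_spread_def)
  note le = coherence_upper[OF pack]
  \<comment> \<open>Lowering requires a positive bound. Coherence at most 0 would make the members
    mutually orthogonal, giving \<open>n * r < CARD('m)\<close> against
    \<open>CARD('m) \<le> n\<close>.\<close>
  have pos: "0 < ?\<mu>"
  proof (rule ccontr)
    assume "\<not> 0 < ?\<mu>"
    then have "N j ** N k = 0" if "j \<in> {1..n}" "k \<in> {1..n}" "j \<noteq> k" for j k
    proof -
      have "N j \<bullet> N k = (norm (N j ** N k))\<^sup>2"
        using pack that by (simp add: packing_def inner_orth_projections)
      then have "(norm (N j ** N k))\<^sup>2 \<le> 0"
        using le[OF that] \<open>\<not> 0 < ?\<mu>\<close> by linarith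
      then show ?thesis by simp
    qed
    then have "n * r < CARD('m)"
      using orthogonal_packing_bound[OF pack x] by blast
    moreover have "n \<le> n * r" using \<open>0 < r\<close> by simp
    ultimately show False using \<open>CARD('m) \<le> n\<close> by linarith
  qed
  have unit: "norm ((1 / norm x) *\<^sub>R x) = 1" using x(1) by simp
  have kernel: "N j *v ((1 / norm x) *\<^sub>R x) = 0" if "j \<in> {1..n}" for j
    using x(2)[OF that] by (simp add: matrix_vector_scaleR)
  obtain M :: "nat \<Rightarrow> 'a ^ 'm ^ 'm" where M: "packing n r M"
    "\<forall>j\<in>{1..n}. \<forall>k\<in>{1..n}. j \<noteq> k \<longrightarrow> M j \<bullet> M k < ?\<mu>"
    using exists_packing_below[OF pack unit kernel pos le] by blast
  \<comment> \<open>The maximum is attained at some pair, so the strict bound on pairs passes to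
    it.\<close>
  then have "coherence n M < ?\<mu>"
    using coherence_attained[OF M(1) \<open>2 \<le> n\<close>] by metis
  then show False
    using N M(1) optimally_spread_iff[OF \<open>2 \<le> n\<close>] by (metis not_le)
qed

text \<open>The quadratic form of the sum at \<open>x\<close> is the sum of the squared norms of
  \<open>N j *v x\<close>, and some \<open>N j\<close> does not kill \<open>x\<close>.\<close>

lemma optimally_spread_positive_definite:
  fixes N :: "nat \<Rightarrow> 'a::real_or_complex_field ^ 'm ^ 'm"
  assumes N: "optimally_spread n r N" and "0 < r" "CARD('m) \<le> n" "2 \<le> n"
  shows "positive_definite (\<Sum>j = 1..n. N j)"
  unfolding positive_definite_def
proof (intro conjI allI impI)
  have proj: "orth_projection (N j)" if "j \<in> {1..n}" for j
    using N that by (simp add: optimally_spread_def packing_def)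
  have "conj_transpose (\<Sum>j\<in>J. N j) = (\<Sum>j\<in>J. conj_transpose (N j))" for J
    by (induction J rule: infinite_finite_induct)
      (simp_all add: conj_transpose_zero conj_transpose_add)
  then show "conj_transpose (\<Sum>j = 1..n. N j) = (\<Sum>j = 1..n. N j)"
    using proj by (simp add: orth_projectionD)
  fix x :: "'a ^ 'm"
  assume "x \<noteq> 0"
  then obtain j where "j \<in> {1..n}" "N j *v x \<noteq> 0"
    using optimally_spread_no_common_kernel[OF assms] by blast
  then have "0 < (\<Sum>j = 1..n. (norm (N j *v x))\<^sup>2)"
    by (intro sum_pos2[of _ j]) auto
  also have "\<dots> = x \<bullet> ((\<Sum>j = 1..n. N j) *v x)"
    using proj by (simp add: matrix_vector_mult_sum_left inner_sum_right orth_projection_inner)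
  finally show "0 < x \<bullet> ((\<Sum>j = 1..n. N j) *v x)" .
qed

lemma grassmannian_spatial_complement:
  fixes P :: "nat \<Rightarrow> 'a::real_or_complex_field ^ 'm ^ 'm"
  assumes P: "grassmannian_fusion_frame n l P" and l: "0 < l" "l < CARD('m)" and n: "CARD('m) \<le> n"
  shows "grassmannian_fusion_frame n (CARD('m) - l) (spatial_complement P) \<and>
    packing_constant TYPE('a ^ 'm) n (CARD('m) - l) =
      real CARD('m) - 2 * real l + packing_constant TYPE('a ^ 'm) n l"
proof -
  \<comment> \<open>This puts a pair of distinct indices under the \<open>Max\<close> in
    \<open>coherence\<close>.\<close>
  have "2 \<le> n" using l n by linarith
  have P': "optimally_spread n l P" using P by (simp add: grassmannian_fusion_frame_def)
  then have N: "optimally_spread n (CARD('m) - l) (spatial_complement P)"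
    using optimally_spread_spatial_complement \<open>2 \<le> n\<close> l by (metis less_imp_le)
  have "positive_definite (\<Sum>j = 1..n. spatial_complement P j)"
    using optimally_spread_positive_definite[OF N _ n \<open>2 \<le> n\<close>] l by simp
  then have "grassmannian_fusion_frame n (CARD('m) - l) (spatial_complement P)"
    using N by (simp add: grassmannian_fusion_frame_def fusion_frame_def optimally_spread_def)
  moreover have "coherence n (spatial_complement P) = real CARD('m) - 2 * real l + coherence n P"
    using coherence_spatial_complement P' l \<open>2 \<le> n\<close> by (metis less_imp_le optimally_spread_def)
  \<comment> \<open>Both packings attain their packing constants, so the shift of coherences is the
    shift of the constants.\<close>
  ultimately show ?thesis
    using N P' by (simp add: optimally_spread_def)
qed

theorem theorem3p4:
  fixes l n :: nat
  assumes "0 < l" and "l < CARD('m::finite)" and "CARD('m) \<le> n"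
  shows
    "(\<forall>P :: nat \<Rightarrow> real ^ 'm ^ 'm.
        grassmannian_fusion_frame n l P \<longrightarrow>
          grassmannian_fusion_frame n (CARD('m) - l) (spatial_complement P) \<and>
          packing_constant TYPE(real ^ 'm) n (CARD('m) - l) =
            real CARD('m) - 2 * real l + packing_constant TYPE(real ^ 'm) n l) \<and>
     (\<forall>P :: nat \<Rightarrow> complex ^ 'm ^ 'm.
        grassmannian_fusion_frame n l P \<longrightarrow>
          grassmannian_fusion_frame n (CARD('m) - l) (spatial_complement P) \<and>
          packing_constant TYPE(complex ^ 'm) n (CARD('m) - l) =
            real CARD('m) - 2 * real l + packing_constant TYPE(complex ^ 'm) n l)"
  by (rule conjI; intro allI impI grassmannian_spatial_complement assms; assumption)

end
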